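(* For any integer $p\ge4$, $$\mathcal{M}^{\mathrm{EE}}_p(\{0\})\ge\frac{\sqrt3}{2e^2}\cdot\frac{\left(\sqrt[4]{3}\,e\right)^p}{p}>0.117\cdot\frac{3.577^p}{p}.$$
   Context: Explicit Euler (EE) extrapolation of order $p\ge2$ on the test equation $U'=\lambda U$, with $z=\tau\lambda\in\mathbb{C}$ and internal perturbations: given $U_n$ and residuals $\tilde r_{m,j}\in\mathbb{C}$ ($1\le m\le p$, $1\le j\le m$), set $$\widetilde Y_{m,0}=U_n,\qquad \widetilde Y_{m,j}=\Big(1+\frac zm\Big)\widetilde Y_{m,j-1}+\tilde r_{m,j}\ (1\le j\le m),\qquad T_{m,1}=\widetilde Y_{m,m},$$ $$T_{j,k}=T_{j,k-1}+\frac{T_{j,k-1}-T_{j-1,k-1}}{\frac{j}{j-k+1}-1}\quad(2\le k\le j\le p),\qquad U_{n+1}=T_{p,p}.$$ Then $U_{n+1}=P(z)U_n+\sum_{m=1}^p\sum_{\ell=1}^mQ^{\mathrm{EE}}_{p,m,\ell}(z)\,\tilde r_{m,\ell}$, which defines the internal stability polynomials $Q^{\mathrm{EE}}_{p,m,\ell}$. For $\mathcal{S}\subset\mathbb{C}$, $$\mathcal{M}^{\mathrm{EE}}_p(\mathcal{S}):=\max_{1\le m\le p}\max_{1\le\ell\le m}\sup_{z\in\mathcal{S}}|Q^{\mathrm{EE}}_{p,m,\ell}(z)|,$$ so that $\mathcal{M}^{\mathrm{EE}}_p(\{0\})=\max_{m,\ell}|Q^{\mathrm{EE}}_{p,m,\ell}(0)|$.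 *)

theory Defs
  imports Complex_Main "HOL-Computational_Algebra.Polynomial" "HOL-Library.Extended_Real"
begin

text \<open>
  Explicit Euler extrapolation on the test equation. Here \<open>z\<close> is the step size times the
  eigenvalue, \<open>U\<close> is the value at the beginning of the step and \<open>r m j\<close> is the residual in the
  \<open>j\<close>-th substep of the \<open>m\<close>-th Euler approximation; only \<open>r m j\<close> with
  \<open>1 \<le> j \<le> m\<close> is ever used.
\<close>

primrec EE_Y :: "complex \<Rightarrow> complex \<Rightarrow> (nat \<Rightarrow> nat \<Rightarrow> complex) \<Rightarrow> nat \<Rightarrow> nat \<Rightarrow> complex" where
  "EE_Y z U r m 0 = U"
| "EE_Y z U r m (Suc j) = (1 + z / of_nat m) * EE_Y z U r m j + r m (Suc j)"

text \<open>
  The extrapolation table is indexed from 1; only the entries with \<open>1 \<le> k \<le> j\<close> are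
  meaningful, and these depend only on entries of the same kind.
\<close>

fun EE_T :: "complex \<Rightarrow> complex \<Rightarrow> (nat \<Rightarrow> nat \<Rightarrow> complex) \<Rightarrow> nat \<Rightarrow> nat \<Rightarrow> complex" where
  "EE_T z U r j k =
     (if k \<le> 1 then EE_Y z U r j j
      else EE_T z U r j (k - 1)
         + (EE_T z U r j (k - 1) - EE_T z U r (j - 1) (k - 1))
             / (of_nat j / (of_nat j - of_nat k + 1) - 1))"

declare EE_T.simps [simp del]

definition EE_step :: "nat \<Rightarrow> complex \<Rightarrow> complex \<Rightarrow> (nat \<Rightarrow> nat \<Rightarrow> complex) \<Rightarrow> complex" where
  "EE_step p z U r = EE_T z U r p p"

definition EE_expansion ::
    "nat \<Rightarrow> complex poly \<Rightarrow> (nat \<Rightarrow> nat \<Rightarrow> complex poly) \<Rightarrow> bool" where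
  "EE_expansion p P Q \<longleftrightarrow>
     (\<forall>z U r. EE_step p z U r =
        poly P z * U + (\<Sum>m=1..p. \<Sum>l=1..m. poly (Q m l) z * r m l))"

text \<open>
  The internal stability polynomials. The description is proper for \<open>1 \<le> l \<le> m \<le> p\<close>; see
  \<open>EE_expansion_unique\<close> and \<open>EE_expansion_EE_Q\<close> below.
\<close>

definition EE_Q :: "nat \<Rightarrow> nat \<Rightarrow> nat \<Rightarrow> complex poly" where
  "EE_Q p m l = (THE q. \<exists>P Q. EE_expansion p P Q \<and> Q m l = q)"

text \<open>The supremum is taken in the extended reals, since it is infinite for some unbounded sets.\<close>

definition EE_M :: "nat \<Rightarrow> complex set \<Rightarrow> ereal" where
  "EE_M p S = (MAX m\<in>{1..p}. MAX l\<in>{1..m}. SUP z\<in>S. ereal (cmod (poly (EE_Q p m l) z)))"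

lemma sum_unit:
  fixes c :: complex and l m p :: nat
  assumes "1 \<le> l" "l \<le> m" "m \<le> p"
  shows "(\<Sum>m'=1..p. \<Sum>l'=1..m'. if m' = m \<and> l' = l then c else 0) = c"
proof -
  have inner: "(\<Sum>l'=1..m'. if m' = m \<and> l' = l then c else 0) = (if m' = m then c else 0)" for m'
    using assms by (cases "m' = m") (simp_all add: sum.delta)
  show ?thesis
    unfolding inner using assms by (simp add: sum.delta)
qed

lemma EE_expansion_unique:
  assumes "EE_expansion p P Q" "EE_expansion p P' Q'"
    and ml: "1 \<le> l" "l \<le> m" "m \<le> p"
  shows "Q m l = Q' m l"
proof -
  let ?r = "\<lambda>m' l'. if m' = m \<and> l' = l then 1 else (0::complex)"
  have unit: "(\<Sum>m'=1..p. \<Sum>l'=1..m'. poly (R m' l') z * ?r m' l') = poly (R m l) z"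
    for R :: "nat \<Rightarrow> nat \<Rightarrow> complex poly" and z
  proof -
    have "(\<Sum>m'=1..p. \<Sum>l'=1..m'. poly (R m' l') z * ?r m' l')
        = (\<Sum>m'=1..p. \<Sum>l'=1..m'. if m' = m \<and> l' = l then poly (R m l) z else 0)"
      by (intro sum.cong refl) simp
    also have "\<dots> = poly (R m l) z"
      using ml by (intro sum_unit) auto
    finally show ?thesis .
  qed
  have "poly (Q m l) z = poly (Q' m l) z" for z
  proof -
    have "EE_step p z 0 ?r = poly (Q m l) z"
      using assms(1) unit[of Q z] unfolding EE_expansion_def by simp
    moreover have "EE_step p z 0 ?r = poly (Q' m l) z"
      using assms(2) unit[of Q' z] unfolding EE_expansion_def by simp
    ultimately show ?thesis by simp
  qed
  then show ?thesis by (intro poly_eq_poly_eq_iff[THEN iffD1] ext)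
qed

context
  fixes p :: nat
begin

private definition expandable ::
    "(complex \<Rightarrow> complex \<Rightarrow> (nat \<Rightarrow> nat \<Rightarrow> complex) \<Rightarrow> complex) \<Rightarrow> bool" where
  "expandable F \<longleftrightarrow> (\<exists>P Q. \<forall>z U r. F z U r =
     poly P z * U + (\<Sum>m=1..p. \<Sum>l=1..m. poly (Q m l) z * r m l))"

private lemma expandable_U: "expandable (\<lambda>z U r. U)"
  unfolding expandable_def by (rule exI[of _ 1], rule exI[of _ "\<lambda>_ _. 0"]) simp

private lemma expandable_r:
  assumes "1 \<le> l" "l \<le> m" "m \<le> p"
  shows "expandable (\<lambda>z U r. r m l)"
proof -
  let ?Q = "\<lambda>m' l'. if m' = m \<and> l' = l then 1 else (0::complex poly)"
  have "(\<Sum>m'=1..p. \<Sum>l'=1..m'. poly (?Q m' l') z * r m' l') = r m l" for z r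
  proof -
    have "(\<Sum>m'=1..p. \<Sum>l'=1..m'. poly (?Q m' l') z * r m' l')
        = (\<Sum>m'=1..p. \<Sum>l'=1..m'. if m' = m \<and> l' = l then r m l else 0)"
      by (intro sum.cong refl) simp
    also have "\<dots> = r m l"
      using assms by (intro sum_unit) auto
    finally show ?thesis .
  qed
  then show ?thesis
    unfolding expandable_def by (intro exI[of _ 0] exI[of _ ?Q]) simp
qed

private lemma expandable_add:
  assumes "expandable F" "expandable G"
  shows "expandable (\<lambda>z U r. F z U r + G z U r)"
proof -
  obtain P Q where F: "\<And>z U r. F z U r =
     poly P z * U + (\<Sum>m=1..p. \<Sum>l=1..m. poly (Q m l) z * r m l)"
    using assms(1) unfolding expandable_def by blast
  obtain P' Q' where G: "\<And>z U r. G z U r =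
     poly P' z * U + (\<Sum>m=1..p. \<Sum>l=1..m. poly (Q' m l) z * r m l)"
    using assms(2) unfolding expandable_def by blast
  show ?thesis
    unfolding expandable_def
    by (rule exI[of _ "P + P'"], rule exI[of _ "\<lambda>m l. Q m l + Q' m l"])
       (simp add: F G sum.distrib algebra_simps)
qed

private lemma expandable_mult:
  assumes "expandable F"
  shows "expandable (\<lambda>z U r. poly c z * F z U r)"
proof -
  obtain P Q where F: "\<And>z U r. F z U r =
     poly P z * U + (\<Sum>m=1..p. \<Sum>l=1..m. poly (Q m l) z * r m l)"
    using assms(1) unfolding expandable_def by blast
  show ?thesis
    unfolding expandable_def
    by (rule exI[of _ "c * P"], rule exI[of _ "\<lambda>m l. c * Q m l"])
       (simp add: F sum_distrib_left algebra_simps)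
qed

private lemma expandable_Y:
  assumes "m \<le> p" "j \<le> m"
  shows "expandable (\<lambda>z U r. EE_Y z U r m j)"
  using assms(2)
proof (induction j)
  case 0
  then show ?case by (simp add: expandable_U)
next
  case (Suc j)
  have "expandable (\<lambda>z U r. poly [:1, 1 / of_nat m:] z * EE_Y z U r m j + r m (Suc j))"
    using Suc assms(1) by (intro expandable_add expandable_mult expandable_r) auto
  then show ?case by simp
qed

private lemma expandable_T:
  assumes "j \<le> p" "k \<le> j"
  shows "expandable (\<lambda>z U r. EE_T z U r j k)"
  using assms
proof (induction k arbitrary: j)
  case 0
  then show ?case by (simp add: EE_T.simps[of _ _ _ _ 0] expandable_Y)
next
  case (Suc k)
  show ?case
  proof (cases "k = 0")
    case True
    with Suc show ?thesis by (simp add: EE_T.simps[of _ _ _ _ "Suc 0"] expandable_Y)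
  next
    case False
    let ?d = "of_nat j / (of_nat j - of_nat (Suc k) + 1) - 1 :: complex"
    have "expandable (\<lambda>z U r. poly [:1 + 1 / ?d:] z * EE_T z U r j k
            + poly [:- 1 / ?d:] z * EE_T z U r (j - 1) k)"
      using Suc by (intro expandable_add expandable_mult) auto
    moreover have "(\<lambda>z U r. poly [:1 + 1 / ?d:] z * EE_T z U r j k
            + poly [:- 1 / ?d:] z * EE_T z U r (j - 1) k) = (\<lambda>z U r. EE_T z U r j (Suc k))"
      using False
      by (intro ext, subst (3) EE_T.simps) (simp add: diff_divide_distrib algebra_simps)
    ultimately show ?thesis by simp
  qed
qed

lemma EE_expansion_exists: "\<exists>P Q. EE_expansion p P Q"
  using expandable_T[of p p] unfolding expandable_def EE_expansion_def EE_step_def by simp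

end

lemma EE_Q_eq:
  assumes "EE_expansion p P Q" "1 \<le> l" "l \<le> m" "m \<le> p"
  shows "EE_Q p m l = Q m l"
  unfolding EE_Q_def
  using assms EE_expansion_unique[OF _ assms(1)] by (intro the_equality) blast+

lemma EE_expansion_EE_Q: "\<exists>P. EE_expansion p P (EE_Q p)"
proof -
  obtain P Q where *: "EE_expansion p P Q" using EE_expansion_exists by blast
  have "(\<Sum>m=1..p. \<Sum>l=1..m. poly (EE_Q p m l) z * r m l)
      = (\<Sum>m=1..p. \<Sum>l=1..m. poly (Q m l) z * r m l)" for z r
    by (intro sum.cong refl) (simp add: EE_Q_eq[OF *])
  with * have "EE_expansion p P (EE_Q p)" unfolding EE_expansion_def by simp
  then show ?thesis ..
qed

end

theory Submission
  imports Defs "HOL-Analysis.Harmonic_Numbers"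
begin

text \<open>
  At \<open>z = 0\<close> every Euler substep only adds its residual, so \<open>Q\<^bsub>p,m,l\<^esub>(0)\<close> does not depend on
  \<open>l\<close>: it is the weight that the extrapolation gives to \<open>T\<^bsub>m,1\<^esub>\<close>. The table entry
  \<open>T\<^bsub>j,n+1\<^esub>\<close> is \<open>1/n!\<close> times the \<open>n\<close>-th backward difference, taken at \<open>x = j\<close>, of the sequence
  \<open>x \<mapsto> x\<^sup>n T\<^bsub>x,1\<^esub>\<close> (\<open>EE_T_eq_backward_difference\<close>), and reading off the weight for \<open>j = p = n + 1\<close>
  gives \<open>\<bar>Q\<^bsub>p,m,l\<^esub>(0)\<bar> = m\<^sup>p / (m! (p - m)!)\<close> (\<open>norm_EE_Q_at_0\<close>).

  One good choice of \<open>m\<close> is enough for a lower bound. The Stirling-type estimate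
  \<open>k! \<le> e \<surd>k (k/e)\<^sup>k\<close> for both factorials, and \<open>\<surd>(m n) \<le> (m + n)/2\<close>, bound the weight with
  \<open>n = p - m\<close> from below by \<open>2 e\<^sup>p / (e\<^sup>2 p) (m/n)\<^sup>n\<close> (\<open>weight_ge\<close>). As a function of a real
  \<open>n\<close>, \<open>(m/n)\<^sup>n\<close> is near its largest at \<open>n = p/4\<close>, where it is \<open>3\<close> to the power \<open>p/4\<close>; this is
  the origin of the base \<open>3\<close> to the power \<open>1/4\<close>, times \<open>e\<close>. Rounding \<open>p/4\<close> down keeps
  \<open>m/n \<ge> 3\<close> and loses at most a factor \<open>3\<close> to the power \<open>3/4\<close>; the constant \<open>\<surd>3/4\<close> absorbs
  this, because \<open>3\<^sup>5 \<le> 4\<^sup>4\<close> (\<open>three_power_ge\<close>). The condition \<open>p \<ge> 4\<close> makes the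
  rounded \<open>n\<close> positive.
\<close>

section \<open>The extrapolation table as a backward difference\<close>

text \<open>
  With \<open>j / (j - k + 1) - 1 = (k - 1) / (j - k + 1)\<close> and \<open>k = n + 2\<close> the recursion reads
  \<open>(n + 1) T\<^bsub>j,n+2\<^esub> = j T\<^bsub>j,n+1\<^esub> - (j - n - 1) T\<^bsub>j-1,n+1\<^esub>\<close>. Comparing the coefficients of the
  shifted sums, the induction step is Pascal's rule together with
  \<open>(n + 1) \<cdot> (n choose i) = (i + 1) \<cdot> (n + 1 choose i + 1)\<close>.
\<close>

lemma EE_T_eq_backward_difference:
  assumes "n < j"
  shows "EE_T z U r j (Suc n) =
    (\<Sum>i\<le>n. (-1) ^ i * of_nat (n choose i) * of_nat (j - i) ^ n * EE_Y z U r (j - i) (j - i))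
      / fact n"
  using assms
proof (induction n arbitrary: j)
  case 0
  show ?case by (subst EE_T.simps) simp
next
  case (Suc n)
  define b :: "nat \<Rightarrow> complex"
    where "b i = (-1) ^ i * of_nat (j - i) ^ n * EE_Y z U r (j - i) (j - i)" for i
  let ?C = "\<lambda>n i. of_nat (n choose i) :: complex"
  let ?S = "\<Sum>i\<le>n. ?C n i * b i" and ?S' = "\<Sum>i\<le>n. ?C n i * b (Suc i)"
  let ?R = "\<Sum>i\<le>Suc n. ?C (Suc n) i * (of_nat (j - i) * b i)"
  have T: "EE_T z U r j (Suc n) = ?S / fact n"
    using Suc by (simp add: b_def mult_ac)
  have T': "EE_T z U r (j - Suc 0) (Suc n) = - ?S' / fact n"
  proof -
    have "EE_T z U r (j - Suc 0) (Suc n) = (\<Sum>i\<le>n. - (?C n i * b (Suc i))) / fact n"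
      using Suc by (simp add: b_def mult_ac diff_diff_eq)
    then show ?thesis by (simp add: sum_negf)
  qed
  have "of_nat j * ?S = (\<Sum>i\<le>Suc n. of_nat j * (?C n i * b i))"
    by (simp add: sum_distrib_left)
  also have "\<dots> = of_nat j * b 0 + (\<Sum>i\<le>n. of_nat j * (?C n (Suc i) * b (Suc i)))"
    by (subst sum.atMost_Suc_shift) simp
  finally have S: "of_nat j * ?S =
      of_nat j * b 0 + (\<Sum>i\<le>n. of_nat j * (?C n (Suc i) * b (Suc i)))" .
  have coeff: "of_nat j * ?C n (Suc i) + (of_nat j - of_nat (Suc n)) * ?C n i
      = ?C (Suc n) (Suc i) * of_nat (j - Suc i)" if "i \<le> n" for i
  proof -
    have "of_nat (Suc n) * ?C n i = ?C (Suc n) (Suc i) * of_nat (Suc i)"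
      by (metis Suc_times_binomial_eq of_nat_mult)
    then show ?thesis
      using that Suc.prems by (simp add: of_nat_diff algebra_simps)
  qed
  have "of_nat j * ?S + (of_nat j - of_nat (Suc n)) * ?S'
      = of_nat j * b 0 + (\<Sum>i\<le>n. (of_nat j * ?C n (Suc i)
          + (of_nat j - of_nat (Suc n)) * ?C n i) * b (Suc i))"
    unfolding S by (simp only: sum_distrib_left sum.distrib distrib_right mult.assoc add.assoc)
  also have "\<dots> = of_nat j * b 0
      + (\<Sum>i\<le>n. ?C (Suc n) (Suc i) * (of_nat (j - Suc i) * b (Suc i)))"
    by (simp add: coeff mult.assoc del: of_nat_Suc binomial_Suc_Suc)
  also have "\<dots> = ?R"
    by (subst sum.atMost_Suc_shift) simp
  finally have R: "of_nat j * ?S + (of_nat j - of_nat (Suc n)) * ?S' = ?R" .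
  have nz: "of_nat j - of_nat (Suc n) \<noteq> (0::complex)"
    using Suc.prems by (metis eq_iff_diff_eq_0 less_irrefl of_nat_eq_iff)
  have "of_nat j / (of_nat j - of_nat (Suc (Suc n)) + 1) - 1
      = of_nat (Suc n) / (of_nat j - of_nat (Suc n) :: complex)"
    using nz by (simp add: field_simps)
  then have "EE_T z U r j (Suc (Suc n)) = ?S / fact n
      + (?S / fact n + ?S' / fact n) / (of_nat (Suc n) / (of_nat j - of_nat (Suc n)))"
    by (subst EE_T.simps) (simp add: T T' del: of_nat_Suc)
  also have "\<dots> = (of_nat j * ?S + (of_nat j - of_nat (Suc n)) * ?S') / fact (Suc n)"
  proof -
    have "s / f + (s / f + s' / f) / (N / (J - N)) = (J * s + (J - N) * s') / (N * f)"
      if "N \<noteq> 0" "f \<noteq> 0" "J - N \<noteq> 0" for s s' f N J :: complex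
      using that by (simp add: field_simps)
    then show ?thesis
      using nz by (simp del: of_nat_Suc)
  qed
  also have "\<dots> = (\<Sum>i\<le>Suc n. (-1) ^ i * ?C (Suc n) i * of_nat (j - i) ^ Suc n
      * EE_Y z U r (j - i) (j - i)) / fact (Suc n)"
    by (simp only: R) (simp add: b_def mult_ac)
  finally show ?case .
qed

section \<open>The internal stability polynomials at the origin\<close>

text \<open>
  With \<open>U = 0\<close> and a single unit residual, the step returns one coefficient of its expansion, so
  this response determines the internal stability polynomials at the origin.
\<close>

lemma EE_Y_unit_residual:
  assumes "1 \<le> l" "l \<le> m"
  shows "EE_Y 0 0 (\<lambda>m' l'. if m' = m \<and> l' = l then 1 else 0) m' m' = (if m' = m then 1 else 0)"
proof -
  have "EE_Y 0 0 (\<lambda>m' l'. if m' = m \<and> l' = l then 1 else 0) m' j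
      = (if m' = m \<and> l \<le> j then 1 else 0)" for j
    using assms by (induction j) auto
  then show ?thesis using assms by simp
qed

lemma norm_EE_Q_at_0:
  assumes "1 \<le> l" "l \<le> m" "m \<le> p"
  shows "cmod (poly (EE_Q p m l) 0) = real m ^ p / (fact m * fact (p - m))"
proof -
  let ?r = "\<lambda>m' l'. if m' = m \<and> l' = l then 1 else (0::complex)"
  obtain P where "EE_expansion p P (EE_Q p)"
    using EE_expansion_EE_Q by blast
  then have "EE_step p 0 0 ?r = (\<Sum>m'=1..p. \<Sum>l'=1..m'. poly (EE_Q p m' l') 0 * ?r m' l')"
    by (simp add: EE_expansion_def)
  also have "\<dots> = (\<Sum>m'=1..p. \<Sum>l'=1..m'. if m' = m \<and> l' = l then poly (EE_Q p m l) 0 else 0)"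
    by (intro sum.cong refl) simp
  also have "\<dots> = poly (EE_Q p m l) 0"
    by (rule sum_unit[OF assms])
  finally have Q: "poly (EE_Q p m l) 0 = EE_step p 0 0 ?r" ..
  obtain n where p: "p = Suc n"
    using assms by (cases p) auto
  have eq: "p - i = m \<longleftrightarrow> i = p - m" if "i \<le> n" for i
    using that assms p by auto
  have "EE_step p 0 0 ?r = (\<Sum>i\<le>n. (-1) ^ i * of_nat (n choose i) * of_nat (p - i) ^ n
      * EE_Y 0 0 ?r (p - i) (p - i)) / fact n"
    unfolding EE_step_def by (subst (2) p, rule EE_T_eq_backward_difference) (simp add: p)
  also have "\<dots> = (\<Sum>i\<le>n. if i = p - m
      then (-1) ^ (p - m) * of_nat (n choose (p - m)) * of_nat m ^ n else 0) / fact n"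
    unfolding EE_Y_unit_residual[OF assms(1,2)]
    by (intro arg_cong2[of _ _ _ _ "(/)"] sum.cong refl) (use eq assms in auto)
  also have "\<dots> = (-1) ^ (p - m) * of_nat (n choose (p - m)) * of_nat m ^ n / fact n"
    using assms p by simp
  finally have "cmod (poly (EE_Q p m l) 0) = real (n choose (p - m)) * real m ^ n / fact n"
    by (simp add: Q norm_mult norm_divide norm_power)
  also have "real (n choose (p - m)) = fact n / (fact (p - m) * fact (m - 1))"
  proof -
    have "p - m \<le> n" "n - (p - m) = m - 1"
      using assms p by auto
    then show ?thesis by (simp add: binomial_fact)
  qed
  also have "fact n / (fact (p - m) * fact (m - 1)) * real m ^ n / fact n
      = real m ^ p / (fact m * fact (p - m))"
  proof -
    have "(fact m :: real) = real m * fact (m - 1)"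
      using assms by (simp add: fact_reduce)
    then show ?thesis
      using assms by (simp add: p)
  qed
  finally show ?thesis .
qed

lemma EE_M_singleton_ge:
  assumes "1 \<le> l" "l \<le> m" "m \<le> p"
  shows "ereal (cmod (poly (EE_Q p m l) z)) \<le> EE_M p {z}"
proof -
  have "ereal (cmod (poly (EE_Q p m l) z))
      \<le> (MAX l\<in>{1..m}. SUP z\<in>{z}. ereal (cmod (poly (EE_Q p m l) z)))"
    using assms by (intro Max_ge) auto
  also have "\<dots> \<le> EE_M p {z}"
    unfolding EE_M_def using assms by (intro Max_ge) auto
  finally show ?thesis .
qed

section \<open>Lower bound for the weights\<close>

text \<open>
  The ratio of the two sides is monotone in \<open>n\<close> and equals \<open>1\<close> at \<open>n = 1\<close>. The step from \<open>n\<close> to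
  \<open>n + 1\<close> amounts to \<open>1 \<le> (n + 1/2) ln (1 + 1/n)\<close>, which says that the midpoint rule
  underestimates the integral of the convex function \<open>1/t\<close> over \<open>[n, n + 1]\<close>.
\<close>

lemma fact_le_exp_sqrt:
  assumes "n \<ge> 1"
  shows "fact n \<le> exp 1 * sqrt (real n) * (real n / exp 1) ^ n"
  using assms
proof (induction n rule: dec_induct)
  case base
  then show ?case by simp
next
  case (step n)
  define x where "x = real n"
  have x: "x \<ge> 1" using step by (simp add: x_def)
  have "2 * ((x + 1) - x) / (x + (x + 1)) \<le> ln (x + 1) - ln x"
    using x by (intro ln_inverse_approx_ge) auto
  then have "1 \<le> (x + 1/2) * (ln (x + 1) - ln x)"
    using x by (simp add: field_simps)
  then have "1 + (x + 1/2) * ln x \<le> (x + 1/2) * ln (x + 1)"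
    by (simp add: algebra_simps)
  then have "exp (1 + (x + 1/2) * ln x) \<le> exp ((x + 1/2) * ln (x + 1))"
    by simp
  moreover have "exp ((x + 1/2) * ln y) = sqrt y * y ^ n" if "y > 0" for y
  proof -
    have "exp ((x + 1/2) * ln y) = y powr x * y powr (1/2)"
      using that by (simp add: powr_def distrib_right exp_add)
    then show ?thesis
      using that by (simp add: x_def powr_realpow powr_half_sqrt)
  qed
  ultimately have key: "exp 1 * (sqrt x * x ^ n) \<le> sqrt (x + 1) * (x + 1) ^ n"
    using x by (simp add: exp_add)
  have "fact (Suc n) = (x + 1) * fact n"
    by (simp add: x_def)
  also have "\<dots> \<le> (x + 1) * (exp 1 * sqrt x * (x / exp 1) ^ n)"
    using step.IH x by (intro mult_left_mono) (auto simp: x_def)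
  also have "\<dots> = (exp 1 * (sqrt x * x ^ n)) * ((x + 1) / exp 1 ^ n)"
    by (simp add: power_divide)
  also have "\<dots> \<le> (sqrt (x + 1) * (x + 1) ^ n) * ((x + 1) / exp 1 ^ n)"
    using x by (intro mult_right_mono key) simp
  also have "\<dots> = exp 1 * sqrt (x + 1) * ((x + 1) / exp 1) ^ Suc n"
    by (simp add: power_divide)
  finally show ?case by (simp add: x_def add.commute)
qed

text \<open>
  In \<open>m\<^bsup>m+n\<^esup> / (m\<^sup>m n\<^sup>n)\<close> the powers with exponent \<open>m\<close> cancel, which leaves \<open>(m/n)\<^sup>n\<close>.
  The square roots from the two factorials are replaced by the mean \<open>(m + n)/2\<close>, which depends on the
  sum only.
\<close>

lemma weight_ge:
  assumes "m \<ge> 1" "n \<ge> 1"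
  shows "2 * exp 1 ^ (m + n) / ((exp 1)\<^sup>2 * real (m + n)) * (real m / real n) ^ n
    \<le> real m ^ (m + n) / (fact m * fact n)"
proof -
  have pos: "real m > 0" "real n > 0" using assms by auto
  have "fact m * fact n \<le> (exp 1 * sqrt (real m) * (real m / exp 1) ^ m)
      * (exp 1 * sqrt (real n) * (real n / exp 1) ^ n)"
    using assms by (intro mult_mono fact_le_exp_sqrt) auto
  also have "\<dots> = (exp 1)\<^sup>2 * sqrt (real m * real n) * (real m ^ m * real n ^ n) / exp 1 ^ (m + n)"
    by (simp add: power_divide power_add power2_eq_square real_sqrt_mult)
  also have "\<dots> \<le> (exp 1)\<^sup>2 * (real (m + n) / 2) * (real m ^ m * real n ^ n) / exp 1 ^ (m + n)"
    using arith_geo_mean_sqrt[of "real m" "real n"]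
    by (intro divide_right_mono mult_right_mono mult_left_mono) auto
  finally have "real m ^ (m + n) / ((exp 1)\<^sup>2 * (real (m + n) / 2) * (real m ^ m * real n ^ n)
      / exp 1 ^ (m + n)) \<le> real m ^ (m + n) / (fact m * fact n)"
    using pos by (intro divide_left_mono) (auto intro!: mult_pos_pos divide_pos_pos)
  then show ?thesis
    using pos by (simp add: power_add power_divide mult_ac)
qed

lemma root_4_3_bounds: "1.316 \<le> root 4 3" "root 4 3 \<le> 1.317"
proof -
  have "root 4 (1.316 ^ 4) \<le> root 4 3" "root 4 3 \<le> root 4 (1.317 ^ 4)"
    by (simp_all add: power_divide)
  then show "1.316 \<le> root 4 3" "root 4 3 \<le> 1.317"
    by (simp_all add: real_root_power_cancel del: power_divide)
qed

text \<open>
  With \<open>r\<close> the fourth root of \<open>3\<close>, the worst case \<open>p = 4 n + 3\<close> is \<open>r\<^sup>2 r\<^sup>3 \<le> 4\<close>, an inequality with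
  little room: \<open>r\<^sup>5\<close> is about \<open>3.95\<close>.
\<close>

lemma three_power_ge:
  assumes "p \<le> 4 * n + 3"
  shows "sqrt 3 / 4 * root 4 3 ^ p \<le> 3 ^ n"
proof -
  let ?r = "root 4 3 :: real"
  have r4: "?r ^ 4 = 3" by simp
  have "(?r\<^sup>2)\<^sup>2 = 3" by (simp flip: power_mult)
  then have r2: "sqrt 3 = ?r\<^sup>2" by (intro real_sqrt_unique) auto
  have r5: "?r ^ 5 \<le> 4"
  proof -
    have "?r ^ 5 \<le> 1.317 ^ 5"
      using root_4_3_bounds by (intro power_mono) auto
    also have "\<dots> \<le> (4::real)" by (simp add: power_divide)
    finally show ?thesis .
  qed
  have "sqrt 3 / 4 * ?r ^ p \<le> ?r\<^sup>2 / 4 * ?r ^ (4 * n + 3)"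
    unfolding r2 using assms root_4_3_bounds by (intro mult_left_mono power_increasing) auto
  also have "\<dots> = 3 ^ n * (?r ^ 5 / 4)"
    by (simp add: power_add power_mult r4 flip: power_Suc)
  also have "\<dots> \<le> 3 ^ n * 1"
    using r5 by (intro mult_left_mono) auto
  finally show ?thesis by simp
qed

lemma exp_1_bounds: "2.7182 \<le> exp (1::real)" "exp (1::real) \<le> 2.72"
proof -
  \<comment> \<open>Eight Taylor terms leave a remainder of at most \<open>3 / 8!\<close>, by the crude bound \<open>e \<le> 3\<close>.\<close>
  obtain t :: real where t: "\<bar>t\<bar> \<le> 1"
    and e: "exp 1 = (\<Sum>k<8. 1 ^ k / fact k) + exp t / fact 8 * 1 ^ 8"
    using Maclaurin_exp_le[of 1 8] by auto
  have "exp 1 = 685 / 252 + exp t / 40320"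
    by (simp add: e lessThan_nat_numeral fact_numeral)
  moreover have "exp t \<le> 3"
    using t exp_le by (smt (verit) exp_le_cancel_iff)
  moreover have "exp t > 0"
    by simp
  ultimately have "13591 / 5000 \<le> exp (1::real) \<and> exp (1::real) \<le> 68 / 25"
    by linarith
  then show "2.7182 \<le> exp (1::real)" "exp (1::real) \<le> 2.72"
    by simp_all
qed

theorem theorem4p17:
  fixes p :: nat
  assumes "p \<ge> 4"
  shows "EE_M p {0} \<ge> ereal (sqrt 3 / (2 * (exp 1)\<^sup>2) * ((root 4 3 * exp 1) ^ p / real p))
       \<and> sqrt 3 / (2 * (exp 1)\<^sup>2) * ((root 4 3 * exp 1) ^ p / real p)
           > 0.117 * (3.577 ^ p / real p)"
proof (rule conjI)
  define n where "n = p div 4"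
  define m where "m = p - n"
  have n: "n \<ge> 1" "p \<le> 4 * n + 3" and m: "3 * n \<le> m" "m \<ge> 1" and p: "p = m + n"
    using assms by (auto simp: n_def m_def)
  have "sqrt 3 / 4 * root 4 3 ^ p \<le> (real m / real n) ^ n"
  proof -
    have "sqrt 3 / 4 * root 4 3 ^ p \<le> 3 ^ n"
      by (rule three_power_ge[OF n(2)])
    also have "\<dots> \<le> (real m / real n) ^ n"
      using n m by (intro power_mono) (auto simp: field_simps)
    finally show ?thesis .
  qed
  then have "2 * exp 1 ^ p / ((exp 1)\<^sup>2 * real p) * (sqrt 3 / 4 * root 4 3 ^ p)
      \<le> 2 * exp 1 ^ p / ((exp 1)\<^sup>2 * real p) * (real m / real n) ^ n"
    by (intro mult_left_mono) auto
  also have "\<dots> \<le> real m ^ p / (fact m * fact n)"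
    unfolding p by (rule weight_ge[OF m(2) n(1)])
  also have "\<dots> = cmod (poly (EE_Q p m 1) 0)"
    using m p by (simp add: norm_EE_Q_at_0)
  finally have "sqrt 3 / (2 * (exp 1)\<^sup>2) * ((root 4 3 * exp 1) ^ p / real p)
      \<le> cmod (poly (EE_Q p m 1) 0)"
    by (simp add: power_mult_distrib mult_ac)
  also have "ereal (cmod (poly (EE_Q p m 1) 0)) \<le> EE_M p {0}"
    using m p by (intro EE_M_singleton_ge) auto
  finally show "EE_M p {0} \<ge> ereal (sqrt 3 / (2 * (exp 1)\<^sup>2) * ((root 4 3 * exp 1) ^ p / real p))"
    by simp
next
  have "0.117 < sqrt 3 / (2 * (exp 1)\<^sup>2)"
  proof -
    have "(exp 1)\<^sup>2 \<le> (2.72::real)\<^sup>2"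
      using exp_1_bounds by (intro power_mono) auto
    moreover have "1.732 \<le> sqrt 3"
      by (rule real_le_rsqrt) (simp add: power2_eq_square)
    ultimately show ?thesis
      by (simp add: field_simps power2_eq_square)
  qed
  moreover have "3.577 ^ p / real p \<le> (root 4 3 * exp 1) ^ p / real p"
  proof -
    have "3.577 \<le> 1.316 * (2.7182::real)" by simp
    also have "\<dots> \<le> root 4 3 * exp 1"
      using root_4_3_bounds exp_1_bounds by (intro mult_mono) auto
    finally show ?thesis
      by (intro divide_right_mono power_mono) auto
  qed
  ultimately show "0.117 * (3.577 ^ p / real p)
      < sqrt 3 / (2 * (exp 1)\<^sup>2) * ((root 4 3 * exp 1) ^ p / real p)"
    using assms by (intro mult_less_le_imp_less) auto
qed

end
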